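(* Let $k\geq 3$. For all $n\geq k+1$, $$\mathrm{sat}_k(n,\text{Berge-}K_3)=\left\lceil\frac{n-1}{k-1}\right\rceil.$$
   Context: Hypergraphs are finite and have no repeated edges; a hypergraph is $k$-uniform if every edge has exactly $k$ vertices. For a graph $F$, a hypergraph $B$ is a Berge-$F$ if (with $V(F)$ identified with distinct vertices of $B$) there is a bijection $\phi:E(F)\to E(B)$ with $e\subseteq\phi(e)$ for all $e\in E(F)$. A hypergraph contains a Berge-$F$ if some subhypergraph of it is a Berge-$F$. A $k$-uniform hypergraph $H$ is Berge-$F$-saturated if $H$ contains no Berge-$F$, but for every $k$-subset $e$ of $V(H)$ with $e\notin E(H)$ the hypergraph $H+e$ contains a Berge-$F$. $\mathrm{sat}_k(n,\text{Berge-}F)$ is the minimum number of edges of a $k$-uniform Berge-$F$-saturated hypergraph on $n$ vertices. $K_3$ is the triangle graph. *)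

theory Defs
  imports Complex_Main
begin

text \<open>
  A hypergraph is a pair of a vertex set and an edge set; edges are vertex sets, so there are
  no repeated edges. Graphs are the 2-uniform hypergraphs.
\<close>

type_synonym 'a hypergraph = "'a set \<times> 'a set set"

abbreviation verts :: "'a hypergraph \<Rightarrow> 'a set" where
  "verts H \<equiv> fst H"

abbreviation edges :: "'a hypergraph \<Rightarrow> 'a set set" where
  "edges H \<equiv> snd H"

definition hypergraph :: "'a hypergraph \<Rightarrow> bool" where
  "hypergraph H \<longleftrightarrow> finite (verts H) \<and> (\<forall>e\<in>edges H. e \<subseteq> verts H)"

definition uniform :: "nat \<Rightarrow> 'a hypergraph \<Rightarrow> bool" where
  "uniform k H \<longleftrightarrow> hypergraph H \<and> (\<forall>e\<in>edges H. card e = k)"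

definition subhypergraph :: "'a hypergraph \<Rightarrow> 'a hypergraph \<Rightarrow> bool" where
  "subhypergraph B H \<longleftrightarrow> hypergraph B \<and> verts B \<subseteq> verts H \<and> edges B \<subseteq> edges H"

definition add_edge :: "'a hypergraph \<Rightarrow> 'a set \<Rightarrow> 'a hypergraph" where
  "add_edge H e = (verts H, insert e (edges H))"

definition complete_graph :: "nat \<Rightarrow> nat hypergraph" where
  "complete_graph r = ({..<r}, {e. e \<subseteq> {..<r} \<and> card e = 2})"

text \<open>
  The injection \<open>f\<close> is the identification of the vertices of the graph \<open>F\<close> with distinct
  vertices of \<open>B\<close>.
\<close>

definition is_Berge :: "'b hypergraph \<Rightarrow> 'a hypergraph \<Rightarrow> bool" where
  "is_Berge F B \<longleftrightarrow> (\<exists>f \<phi>. inj_on f (verts F) \<and> f ` verts F \<subseteq> verts B \<and>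
     bij_betw \<phi> (edges F) (edges B) \<and> (\<forall>e\<in>edges F. f ` e \<subseteq> \<phi> e))"

definition contains_Berge :: "'b hypergraph \<Rightarrow> 'a hypergraph \<Rightarrow> bool" where
  "contains_Berge F H \<longleftrightarrow> (\<exists>B. subhypergraph B H \<and> is_Berge F B)"

definition Berge_saturated :: "nat \<Rightarrow> 'b hypergraph \<Rightarrow> 'a hypergraph \<Rightarrow> bool" where
  "Berge_saturated k F H \<longleftrightarrow> uniform k H \<and> \<not> contains_Berge F H \<and>
     (\<forall>e. e \<subseteq> verts H \<and> card e = k \<and> e \<notin> edges H \<longrightarrow> contains_Berge F (add_edge H e))"

text \<open>
  Vertices are taken to be natural numbers; every finite hypergraph is isomorphic to such a
  hypergraph. The infimum of a nonempty set of natural numbers is its minimum; that of the empty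
  set is 0.
\<close>

definition sat_Berge :: "nat \<Rightarrow> nat \<Rightarrow> 'b hypergraph \<Rightarrow> nat" where
  "sat_Berge k n F =
     Inf {card (edges H) | H :: nat hypergraph. card (verts H) = n \<and> Berge_saturated k F H}"

end

theory Submission
  imports Defs
begin

text \<open>
  Call two vertices linked if two different edges, one through each of them, share a third vertex.
  A new edge completes a first Berge triangle exactly when it contains two distinct linked vertices
  (\<open>Berge_K3_saturated_iff\<close>), so a Berge-triangle-free \<open>k\<close>-uniform hypergraph is saturated iff every
  \<open>k\<close>-set of vertices that is not an edge contains a linked pair.

  Lower bound (\<open>card_verts_le_if_linked\<close>). A saturated hypergraph with \<open>m\<close> edges need not be
  connected, so counting vertices in a connected hypergraph does not suffice. Instead, remove an edge
  \<open>a\<close> that is not a cut edge: all vertices which \<open>a\<close> shares with other edges lie in a single component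
  \<open>D\<close> of the remaining hypergraph. The \<open>m - 1\<close> remaining edges each merge at most \<open>k\<close> components into
  one, so at least \<open>n - (k - 1) (m - 1)\<close> components are left. Vertices taken from different
  components other than \<open>D\<close> are never linked: a link using \<open>a\<close> passes from \<open>a\<close> to another edge and
  hence ends in \<open>D\<close>. By saturation there are fewer than \<open>k\<close> such components, so at most \<open>k\<close>
  components in total, and \<open>n \<le> k + (k - 1) (m - 1) = 1 + (k - 1) m\<close>.

  Upper bound (\<open>exists_Berge_K3_saturated\<close>). If all edges pass through a common vertex \<open>r\<close> and cover
  the vertex set, then any two vertices other than \<open>r\<close> lying in different edges are linked through
  \<open>r\<close>, and every non-edge contains two such vertices. If moreover all pairs of edges, with one
  possible exception, meet only in \<open>r\<close>, there is no Berge triangle, because two of its three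
  connecting vertices would have to be \<open>r\<close>. A sunflower with core \<open>r\<close>, whose last petal is slid back
  into the previous one when \<open>k - 1\<close> does not divide \<open>n - 1\<close>, has these properties and the required
  number of edges.
\<close>

section \<open>Berge triangles and linked vertices\<close>

definition berge_triangle :: "'a set set \<Rightarrow> bool" where
  "berge_triangle E \<longleftrightarrow> (\<exists>a\<in>E. \<exists>b\<in>E. \<exists>c\<in>E. \<exists>x y z. a \<noteq> b \<and> b \<noteq> c \<and> a \<noteq> c \<and>
     x \<noteq> y \<and> y \<noteq> z \<and> x \<noteq> z \<and> x \<in> a \<inter> b \<and> y \<in> b \<inter> c \<and> z \<in> a \<inter> c)"

definition linked :: "'a set set \<Rightarrow> 'a \<Rightarrow> 'a \<Rightarrow> bool" where
  "linked E x y \<longleftrightarrow> (\<exists>b\<in>E. \<exists>c\<in>E. \<exists>z. b \<noteq> c \<and> z \<noteq> x \<and> z \<noteq> y \<and> x \<in> b \<and> y \<in> c \<and> z \<in> b \<inter> c)"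

lemma linkedI:
  assumes "b \<in> E" "c \<in> E" "b \<noteq> c" "z \<noteq> x" "z \<noteq> y" "x \<in> b" "y \<in> c" "z \<in> b" "z \<in> c"
  shows "linked E x y"
  unfolding linked_def using assms
  by (intro bexI[of _ b] bexI[of _ c] exI[of _ z]) auto

lemma berge_triangleI:
  assumes "a \<in> E" "b \<in> E" "c \<in> E" "a \<noteq> b" "b \<noteq> c" "a \<noteq> c" "x \<noteq> y" "y \<noteq> z" "x \<noteq> z"
    and "x \<in> a" "x \<in> b" "y \<in> b" "y \<in> c" "z \<in> a" "z \<in> c"
  shows "berge_triangle E"
  unfolding berge_triangle_def using assms
  by (intro bexI[of _ a] bexI[of _ b] bexI[of _ c] exI[of _ x] exI[of _ y] exI[of _ z]) auto

lemma berge_triangleE: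
  assumes "berge_triangle E"
  obtains a b c x y z where "a \<in> E" "b \<in> E" "c \<in> E" "a \<noteq> b" "b \<noteq> c" "a \<noteq> c"
    "x \<noteq> y" "y \<noteq> z" "x \<noteq> z" "x \<in> a" "x \<in> b" "y \<in> b" "y \<in> c" "z \<in> a" "z \<in> c"
  using assms unfolding berge_triangle_def Int_iff
  by (elim bexE exE conjE) (rule that; assumption)

lemma complete_graph_3: "complete_graph 3 = ({0, 1, 2}, {{0, 1}, {1, 2}, {0, 2}})"
proof -
  have V: "{..<3} = {0, 1, 2 :: nat}" by auto
  have "{e. e \<subseteq> {0, 1, 2 :: nat} \<and> card e = 2} = {{0, 1}, {1, 2}, {0, 2}}"
  proof
    show "{e. e \<subseteq> {0, 1, 2 :: nat} \<and> card e = 2} \<subseteq> {{0, 1}, {1, 2}, {0, 2}}"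
      by (auto simp: card_2_iff)
  qed auto
  then show ?thesis unfolding complete_graph_def V by simp
qed

text \<open>
  The edges \<open>a\<close>, \<open>b\<close>, \<open>c\<close> of a triangle are the images of \<open>{0, 1}\<close>, \<open>{1, 2}\<close>, \<open>{0, 2}\<close>; their
  connecting vertices \<open>x\<close>, \<open>y\<close>, \<open>z\<close> are the images of \<open>1\<close>, \<open>2\<close>, \<open>0\<close>.
\<close>

lemma contains_Berge_K3_iff:
  assumes "hypergraph H"
  shows "contains_Berge (complete_graph 3) H \<longleftrightarrow> berge_triangle (edges H)"
proof
  assume "contains_Berge (complete_graph 3) H"
  then obtain B f and \<phi> :: "nat set \<Rightarrow> 'a set" where B: "edges B \<subseteq> edges H"
    and f: "inj_on f {0, 1, 2 :: nat}"
    and \<phi>: "bij_betw \<phi> {{0, 1}, {1, 2}, {0, 2}} (edges B)"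
    and sub: "f ` {0, 1} \<subseteq> \<phi> {0, 1}" "f ` {1, 2} \<subseteq> \<phi> {1, 2}" "f ` {0, 2} \<subseteq> \<phi> {0, 2}"
    unfolding contains_Berge_def is_Berge_def subhypergraph_def complete_graph_3
    by (auto simp del: One_nat_def)
  let ?a = "\<phi> {0, 1}" and ?b = "\<phi> {1, 2}" and ?c = "\<phi> {0, 2}"
  have "{0, 1} \<noteq> {1, 2 :: nat}" "{1, 2} \<noteq> {0, 2 :: nat}" "{0, 1} \<noteq> {0, 2 :: nat}"
    by (auto simp: doubleton_eq_iff)
  then have "?a \<noteq> ?b \<and> ?b \<noteq> ?c \<and> ?a \<noteq> ?c"
    using bij_betw_imp_inj_on[OF \<phi>] by (metis inj_onD insertCI)
  moreover have "?a \<in> edges H" "?b \<in> edges H" "?c \<in> edges H"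
    using bij_betw_imp_surj_on[OF \<phi>] B by auto
  moreover have "f 1 \<noteq> f 2 \<and> f 2 \<noteq> f 0 \<and> f 1 \<noteq> f 0"
    using f by (auto simp: inj_on_def)
  ultimately show "berge_triangle (edges H)"
    using sub by (intro berge_triangleI[of ?a _ ?b ?c "f 1" "f 2" "f 0"]) auto
next
  assume "berge_triangle (edges H)"
  then obtain a b c x y z where E: "a \<in> edges H" "b \<in> edges H" "c \<in> edges H"
    and d: "a \<noteq> b" "b \<noteq> c" "a \<noteq> c" "x \<noteq> y" "y \<noteq> z" "x \<noteq> z"
    and m: "x \<in> a" "x \<in> b" "y \<in> b" "y \<in> c" "z \<in> a" "z \<in> c"
    by (elim berge_triangleE)
  define f where "f i = (if i = 0 then z else if i = 1 then x else y)" for i :: nat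
  define \<phi> where "\<phi> e = (if 2 \<notin> e then a else if 0 \<notin> e then b else c)" for e :: "nat set"
  have V: "\<forall>e\<in>edges H. e \<subseteq> verts H" and fin: "finite (verts H)"
    using assms by (auto simp: hypergraph_def)
  have "subhypergraph (verts H, {a, b, c}) H"
    using E V fin by (auto simp: subhypergraph_def hypergraph_def)
  moreover have "is_Berge (complete_graph 3) (verts H, {a, b, c})"
    unfolding is_Berge_def complete_graph_3
  proof (intro exI conjI)
    show "inj_on f (verts ({0, 1, 2}, {{0, 1}, {1, 2}, {0, 2}}))"
      using d by (auto simp: inj_on_def f_def)
    show "f ` verts ({0, 1, 2}, {{0, 1}, {1, 2}, {0, 2}}) \<subseteq> verts (verts H, {a, b, c})"
      using m E V by (auto simp: f_def)
    show "bij_betw \<phi> (edges ({0, 1, 2}, {{0, 1}, {1, 2}, {0, 2}})) (edges (verts H, {a, b, c}))"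
      using d by (auto simp: bij_betw_def inj_on_def \<phi>_def)
    show "\<forall>e\<in>edges ({0, 1, 2}, {{0, 1}, {1, 2}, {0, 2}}). f ` e \<subseteq> \<phi> e"
      using m by (auto simp: f_def \<phi>_def)
  qed
  ultimately show "contains_Berge (complete_graph 3) H"
    unfolding contains_Berge_def by blast
qed

text \<open>
  The new edge must take part in the triangle; the other two edges of the triangle link the two
  vertices that the new edge supplies.
\<close>

lemma berge_triangle_insertD:
  assumes "berge_triangle (insert e E)" "\<not> berge_triangle E"
  shows "\<exists>x\<in>e. \<exists>y\<in>e. x \<noteq> y \<and> linked E x y"
proof -
  obtain a b c x y z where E: "a \<in> insert e E" "b \<in> insert e E" "c \<in> insert e E"
    and d: "a \<noteq> b" "b \<noteq> c" "a \<noteq> c" "x \<noteq> y" "y \<noteq> z" "x \<noteq> z"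
    and m: "x \<in> a" "x \<in> b" "y \<in> b" "y \<in> c" "z \<in> a" "z \<in> c"
    using assms(1) by (elim berge_triangleE)
  have "a = e \<or> b = e \<or> c = e"
    using berge_triangleI[of a E b c x y z] assms(2) E d m by blast
  then show ?thesis
  proof (elim disjE)
    assume "a = e"
    then have "linked E x z" "x \<in> e" "z \<in> e"
      using E d m linkedI[of b _ c y x z] by auto
    then show ?thesis using d by blast
  next
    assume "b = e"
    then have "linked E x y" "x \<in> e" "y \<in> e"
      using E d m linkedI[of a _ c z x y] by auto
    then show ?thesis using d by blast
  next
    assume "c = e"
    then have "linked E z y" "z \<in> e" "y \<in> e" "z \<noteq> y"
      using E d m linkedI[of a _ b x z y] by auto
    then show ?thesis by blast
  qed
qed

lemma berge_triangle_insertI: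
  assumes "e \<notin> E" "x \<in> e" "y \<in> e" "x \<noteq> y" "linked E x y"
  shows "berge_triangle (insert e E)"
proof -
  obtain b c z where "b \<in> E" "c \<in> E" "b \<noteq> c" "z \<noteq> x" "z \<noteq> y" "x \<in> b" "y \<in> c" "z \<in> b \<inter> c"
    using assms(5) unfolding linked_def by blast
  moreover from this have "e \<noteq> b" "e \<noteq> c" using assms(1) by auto
  ultimately show ?thesis using assms(2-4)
    by (intro berge_triangleI[of e _ b c x z y]) auto
qed

lemma Berge_K3_saturated_iff:
  assumes "uniform k H"
  shows "Berge_saturated k (complete_graph 3) H \<longleftrightarrow> \<not> berge_triangle (edges H) \<and>
    (\<forall>e. e \<subseteq> verts H \<and> card e = k \<and> e \<notin> edges H \<longrightarrow> (\<exists>x\<in>e. \<exists>y\<in>e. x \<noteq> y \<and> linked (edges H) x y))"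
proof -
  have H: "hypergraph H" using assms by (simp add: uniform_def)
  have "contains_Berge (complete_graph 3) (add_edge H e) \<longleftrightarrow> berge_triangle (insert e (edges H))"
    if "e \<subseteq> verts H" for e
    using contains_Berge_K3_iff[of "add_edge H e"] H that
    by (auto simp: add_edge_def hypergraph_def)
  moreover have "berge_triangle (insert e (edges H)) \<longleftrightarrow> (\<exists>x\<in>e. \<exists>y\<in>e. x \<noteq> y \<and> linked (edges H) x y)"
    if "\<not> berge_triangle (edges H)" "e \<notin> edges H" for e
    using berge_triangle_insertD[OF _ that(1)] berge_triangle_insertI[OF that(2)] by auto
  ultimately show ?thesis
    unfolding Berge_saturated_def contains_Berge_K3_iff[OF H] using assms by auto
qed

section \<open>Components of a hypergraph\<close>

text \<open>
  Each edge merges at most \<open>d + 1\<close> components, which loses at most \<open>d\<close> of them. A colouring that is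
  constant on edges can only separate different components, so it stands in for a choice of component
  labels; merging then amounts to recolouring all colours seen on the new edge by one of them.
\<close>

lemma exists_colouring_constant_on_edges:
  assumes "finite V" "finite E" "\<And>e. e \<in> E \<Longrightarrow> e \<subseteq> V \<and> card e = Suc d"
  shows "\<exists>f :: 'a \<Rightarrow> 'a. (\<forall>e\<in>E. \<forall>x\<in>e. \<forall>y\<in>e. f x = f y) \<and> card V \<le> card (f ` V) + d * card E"
  using assms(2,3)
proof (induction E)
  case empty
  show ?case by (intro exI[of _ id]) simp
next
  case (insert e E)
  then obtain f :: "'a \<Rightarrow> 'a" where f: "\<forall>e\<in>E. \<forall>x\<in>e. \<forall>y\<in>e. f x = f y"
    and card: "card V \<le> card (f ` V) + d * card E"
    by auto
  have e: "e \<subseteq> V" "card e = Suc d" using insert.prems by auto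
  then obtain u where u: "u \<in> e" by fastforce
  define g where "g x = (if f x \<in> f ` e then f u else f x)" for x
  have const: "\<forall>e'\<in>insert e E. \<forall>x\<in>e'. \<forall>y\<in>e'. g x = g y"
  proof (intro ballI)
    fix e' x y assume "e' \<in> insert e E" "x \<in> e'" "y \<in> e'"
    show "g x = g y"
    proof (cases "e' = e")
      case True
      then show ?thesis using \<open>x \<in> e'\<close> \<open>y \<in> e'\<close> by (simp add: g_def)
    next
      case False
      then have "f x = f y" using f \<open>e' \<in> insert e E\<close> \<open>x \<in> e'\<close> \<open>y \<in> e'\<close> by blast
      then show ?thesis by (simp add: g_def)
    qed
  qed
  have "f ` V \<subseteq> g ` V \<union> (f ` e - {f u})"
  proof
    fix c assume "c \<in> f ` V"
    then obtain x where x: "x \<in> V" "c = f x" by blast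
    show "c \<in> g ` V \<union> (f ` e - {f u})"
    proof (cases "c \<in> f ` e \<and> c \<noteq> f u")
      case False
      then have "c = g x" using x by (auto simp: g_def)
      then show ?thesis using x by blast
    qed simp
  qed
  moreover have fin: "finite e" "finite (g ` V)"
    using e(1) assms(1) by (auto intro: finite_subset)
  ultimately have "card (f ` V) \<le> card (g ` V \<union> (f ` e - {f u}))"
    by (intro card_mono) auto
  also have "\<dots> \<le> card (g ` V) + card (f ` e - {f u})" by (rule card_Un_le)
  also have "card (f ` e - {f u}) \<le> d"
    using card_image_le[OF fin(1), of f] e(2) u by (simp add: card_Diff_singleton)
  finally have "card V \<le> card (g ` V) + d * card (insert e E)"
    using card insert.hyps by simp
  with const show ?case by (intro exI[of _ g] conjI)
qed

definition component :: "'a set set \<Rightarrow> 'a \<Rightarrow> 'a set" where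
  "component E v = {w. (v, w) \<in> {(x, y). \<exists>e\<in>E. x \<in> e \<and> y \<in> e}\<^sup>*}"

lemma component_self: "v \<in> component E v"
  by (simp add: component_def)

lemma component_closed:
  assumes "e \<in> E" "x \<in> e" "y \<in> e" "x \<in> component E v"
  shows "y \<in> component E v"
  using assms unfolding component_def by (auto intro: rtrancl_into_rtrancl)

lemma component_least:
  assumes "v \<in> S" "\<And>e x y. e \<in> E \<Longrightarrow> x \<in> e \<Longrightarrow> y \<in> e \<Longrightarrow> x \<in> component E v \<Longrightarrow> x \<in> S \<Longrightarrow> y \<in> S"
  shows "component E v \<subseteq> S"
proof
  fix w assume "w \<in> component E v"
  then have "(v, w) \<in> {(x, y). \<exists>e\<in>E. x \<in> e \<and> y \<in> e}\<^sup>*" by (simp add: component_def)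
  then show "w \<in> S"
  proof (induction rule: rtrancl_induct)
    case (step x y)
    then show ?case using assms(2)[of _ x y] by (auto simp: component_def)
  qed (rule assms(1))
qed

text \<open>
  Choose \<open>a\<close> and \<open>v \<in> a\<close> so that the component of \<open>v\<close> after the removal of \<open>a\<close> is as large as
  possible. If an edge \<open>b\<close> met \<open>a\<close> outside this component, then removing \<open>b\<close> instead would leave
  the component intact and attach it through \<open>a\<close> to a vertex of \<open>b\<close>, giving a larger one.
\<close>

lemma exists_non_cut_edge:
  assumes "finite V" "E \<noteq> {}" "\<And>e. e \<in> E \<Longrightarrow> e \<subseteq> V \<and> e \<noteq> {}"
  shows "\<exists>a\<in>E. \<exists>v\<in>a. \<forall>b\<in>E - {a}. a \<inter> b \<subseteq> component (E - {a}) v"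
proof -
  let ?D = "\<lambda>a v. component (E - {a}) v"
  define P where "P p \<longleftrightarrow> fst p \<in> E \<and> snd p \<in> fst p" for p :: "'a set \<times> 'a"
  have sub: "x \<in> V" if "e \<in> E" "x \<in> e" for e x using assms(3)[OF that(1)] that(2) by auto
  have D_sub: "?D a v \<subseteq> V" if "a \<in> E" "v \<in> a" for a v
    by (rule component_least) (use sub that in auto)
  obtain a0 where "a0 \<in> E" using assms(2) by auto
  moreover obtain v0 where "v0 \<in> a0" using assms(3)[OF \<open>a0 \<in> E\<close>] by auto
  ultimately have "a0 \<in> E" "v0 \<in> a0" by simp_all
  then have "P (a0, v0)" by (simp add: P_def)
  have bound: "\<forall>p. P p \<longrightarrow> card (?D (fst p) (snd p)) < Suc (card V)"
    using D_sub assms(1) by (auto simp: P_def less_Suc_eq_le intro: card_mono)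
  from ex_has_greatest_nat[OF \<open>P (a0, v0)\<close> bound] obtain p where p: "P p"
    and pmax: "\<And>q. P q \<Longrightarrow> card (?D (fst q) (snd q)) \<le> card (?D (fst p) (snd p))"
    by (elim exE conjE) (rule that, assumption, blast)
  obtain a v where [simp]: "p = (a, v)" by (cases p)
  have a: "a \<in> E" "v \<in> a" using p by (auto simp: P_def)
  have max: "card (?D b w) \<le> card (?D a v)" if "b \<in> E" "w \<in> b" for b w
    using pmax[of "(b, w)"] that by (simp add: P_def)
  have "y \<in> ?D a v" if b: "b \<in> E" "b \<noteq> a" and y: "y \<in> a" "y \<in> b" for b y
  proof (rule ccontr)
    assume ny: "y \<notin> ?D a v"
    have disj: "b \<inter> ?D a v = {}"
      using ny component_closed[of b "E - {a}" _ y v] b y by auto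
    have "v \<in> ?D b y"
      using component_closed[of a "E - {b}" y v y] component_self[of y] a b y by auto
    then have "?D a v \<subseteq> ?D b y"
    proof (rule component_least)
      fix e x w assume e: "e \<in> E - {a}" "x \<in> e" "w \<in> e" and x: "x \<in> ?D a v" "x \<in> ?D b y"
      have "e \<noteq> b" using disj e(2) x(1) by auto
      then show "w \<in> ?D b y" using component_closed[OF _ e(2,3) x(2)] e(1) by simp
    qed
    then have "?D a v \<subset> ?D b y" using ny component_self[of y "E - {b}"] by blast
    moreover have "finite (?D b y)" using D_sub[OF b(1) y(2)] assms(1) by (rule finite_subset)
    ultimately have "card (?D a v) < card (?D b y)" by (rule psubset_card_mono[rotated])
    then show False using max[OF b(1) y(2)] by simp
  qed
  then show ?thesis using a by blast
qed

section \<open>The lower bound\<close>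

text \<open>
  If more than \<open>k\<close> colours remained after deleting a non-cut edge \<open>a\<close>, then \<open>k\<close> vertices of
  different colours, none of them the colour of the component in which \<open>a\<close> meets the other edges,
  would form a non-edge without a linked pair.
\<close>

lemma card_verts_le_if_linked:
  assumes fin: "finite V" and unif: "\<And>e. e \<in> E \<Longrightarrow> e \<subseteq> V \<and> card e = k"
    and k: "k \<ge> 2" "k \<le> card V"
    and link: "\<And>e. e \<subseteq> V \<Longrightarrow> card e = k \<Longrightarrow> e \<notin> E \<Longrightarrow> \<exists>x\<in>e. \<exists>y\<in>e. x \<noteq> y \<and> linked E x y"
  shows "card V \<le> 1 + (k - 1) * card E"
proof -
  obtain e0 where e0: "e0 \<subseteq> V" "card e0 = k" using obtain_subset_with_card_n[OF k(2)] by blast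
  have ne: "E \<noteq> {}" using link[OF e0] by (auto simp: linked_def)
  have "E \<subseteq> Pow V" using unif by blast
  then have finE: "finite E" using fin finite_subset by blast
  have unif': "e \<subseteq> V \<and> e \<noteq> {}" if "e \<in> E" for e using unif[OF that] k(1) by auto
  obtain a v where a: "a \<in> E" "v \<in> a"
    and noncut: "\<And>b y. b \<in> E \<Longrightarrow> b \<noteq> a \<Longrightarrow> y \<in> a \<Longrightarrow> y \<in> b \<Longrightarrow> y \<in> component (E - {a}) v"
    using exists_non_cut_edge[OF fin ne unif'] by blast
  have "e \<subseteq> V \<and> card e = Suc (k - 1)" if "e \<in> E - {a}" for e using unif[of e] that k(1) by auto
  then obtain f :: "'a \<Rightarrow> 'a" where f: "\<forall>e\<in>E - {a}. \<forall>x\<in>e. \<forall>y\<in>e. f x = f y"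
    and cf: "card V \<le> card (f ` V) + (k - 1) * card (E - {a})"
    using exists_colouring_constant_on_edges[OF fin, of "E - {a}" "k - 1"] finE by blast
  have "component (E - {a}) v \<subseteq> {w. f w = f v}"
  proof (rule component_least)
    fix e x y assume "e \<in> E - {a}" "x \<in> e" "y \<in> e" "x \<in> {w. f w = f v}"
    moreover from this have "f x = f y" using f by blast
    ultimately show "y \<in> {w. f w = f v}" by simp
  qed simp
  then have fy: "f y = f v" if "b \<in> E" "b \<noteq> a" "y \<in> a" "y \<in> b" for b y
    using noncut[OF that] by blast
  have "card (f ` V - {f v}) < k"
  proof (rule ccontr)
    assume "\<not> card (f ` V - {f v}) < k"
    then obtain C where C: "C \<subseteq> f ` V - {f v}" "card C = k"
      using obtain_subset_with_card_n[of k "f ` V - {f v}"] by (auto simp: not_less)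
    then have "C \<subseteq> f ` V" by blast
    then obtain I where I: "I \<subseteq> V" "inj_on f I" "C = f ` I"
      by (meson subset_image_inj)
    have cI: "card I = k" using C(2) I(2,3) by (simp add: card_image)
    have neq: "f x \<noteq> f v" if "x \<in> I" for x using C(1) I(3) that by blast
    have "I \<notin> E"
    proof
      assume "I \<in> E"
      moreover have "I \<noteq> a" using neq a(2) by blast
      moreover obtain x y where "x \<in> I" "y \<in> I" "x \<noteq> y"
        using cI k(1) by (metis card_le_Suc0_iff_eq card.infinite not_less_eq_eq numeral_2_eq_2 le_zero_eq nat.distinct(1))
      ultimately have "f x = f y" using f by blast
      then show False using I(2) \<open>x \<in> I\<close> \<open>y \<in> I\<close> \<open>x \<noteq> y\<close> by (auto dest: inj_onD)
    qed
    from link[OF I(1) cI this] obtain x y b c z where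
      xy: "x \<in> I" "y \<in> I" "x \<noteq> y" and bc: "b \<in> E" "c \<in> E" "b \<noteq> c"
      and mem: "x \<in> b" "y \<in> c" "z \<in> b" "z \<in> c"
      unfolding linked_def by blast
    have fxy: "f x \<noteq> f y" using I(2) xy by (auto simp: inj_on_def)
    show False
    proof (cases "b = a \<or> c = a")
      \<comment> \<open>Here \<open>z\<close> lies both in \<open>a\<close> and in another edge, and that edge carries the colour of \<open>v\<close>
        on to \<open>x\<close> or \<open>y\<close>.\<close>
      case True
      then have "f z = f v" using fy bc mem by metis
      then show False using True f bc mem neq[OF xy(1)] neq[OF xy(2)] by (metis DiffI singletonD)
    next
      case False
      then show False using f bc mem fxy by (metis DiffI singletonD)
    qed
  qed
  then have "card (f ` V) \<le> k" using fin by (simp add: card_Diff_singleton_if split: if_splits)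
  moreover have "card E = Suc (card (E - {a}))" using card_Suc_Diff1[OF finE a(1)] by simp
  ultimately show ?thesis using cf k(1) by simp
qed

section \<open>The upper bound\<close>

text \<open>
  A triangle needs three pairwise meetings in distinct vertices, but only the pair \<open>{p, q}\<close> can meet
  outside \<open>r\<close>. For a non-edge \<open>e\<close>, take \<open>x \<in> e\<close> other than \<open>r\<close> and an edge \<open>a\<close> through \<open>x\<close>: by
  cardinality \<open>e\<close> has a vertex outside \<open>a\<close>, and an edge through that vertex meets \<open>a\<close> in \<open>r\<close>.
\<close>

lemma Berge_K3_saturated_if_star:
  assumes unif: "uniform k H" and k: "k \<ge> 2"
    and centre: "\<And>e. e \<in> edges H \<Longrightarrow> r \<in> e" and cover: "verts H \<subseteq> \<Union>(edges H)"
    and meet: "\<And>a b. a \<in> edges H \<Longrightarrow> b \<in> edges H \<Longrightarrow> a \<noteq> b \<Longrightarrow> {a, b} \<noteq> {p, q} \<Longrightarrow> a \<inter> b \<subseteq> {r}"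
  shows "Berge_saturated k (complete_graph 3) H"
  unfolding Berge_K3_saturated_iff[OF unif]
proof (intro conjI allI impI)
  show "\<not> berge_triangle (edges H)"
  proof
    assume "berge_triangle (edges H)"
    then obtain a b c x y z where E: "a \<in> edges H" "b \<in> edges H" "c \<in> edges H"
      and d: "a \<noteq> b" "b \<noteq> c" "a \<noteq> c" "x \<noteq> y" "y \<noteq> z" "x \<noteq> z"
      and m: "x \<in> a" "x \<in> b" "y \<in> b" "y \<in> c" "z \<in> a" "z \<in> c"
      by (elim berge_triangleE)
    have "{a, b} \<noteq> {p, q} \<longrightarrow> x = r" "{b, c} \<noteq> {p, q} \<longrightarrow> y = r" "{a, c} \<noteq> {p, q} \<longrightarrow> z = r"
      using subsetD[OF meet[OF E(1,2) d(1)], of x] subsetD[OF meet[OF E(2,3) d(2)], of y]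
        subsetD[OF meet[OF E(1,3) d(3)], of z] m by simp_all
    then show False using d by (metis doubleton_eq_iff)
  qed
next
  fix e assume e: "e \<subseteq> verts H \<and> card e = k \<and> e \<notin> edges H"
  have "\<not> e \<subseteq> {r}" using e k card_mono[of "{r}" e] by auto
  then obtain x where x: "x \<in> e" "x \<noteq> r" by blast
  then obtain a where a: "a \<in> edges H" "x \<in> a" using e cover by blast
  have ca: "card a = k" "finite a"
    using unif a(1) by (auto simp: uniform_def hypergraph_def intro: finite_subset)
  then have "\<not> e \<subseteq> a" using e a(1) card_subset_eq by metis
  then obtain y where y: "y \<in> e" "y \<notin> a" by blast
  then obtain b where b: "b \<in> edges H" "y \<in> b" using e cover by blast
  have "linked (edges H) x y"
    using a b x y centre by (intro linkedI[of a _ b r]) auto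
  moreover have "x \<noteq> y" using a(2) y(2) by auto
  ultimately show "\<exists>x\<in>e. \<exists>y\<in>e. x \<noteq> y \<and> linked (edges H) x y"
    using x(1) y(1) by blast
qed

text \<open>
  The vertex \<open>0\<close> is the core. The other vertices are cut into \<open>m + 1\<close> consecutive blocks of length
  \<open>d\<close> and a remainder of length \<open>s\<close>, and the last edge uses the final \<open>d\<close> vertices. Since \<open>s \<ge> 1\<close>,
  it differs from the edge \<open>A m\<close> of the last full block, which is the only one that it can meet
  outside \<open>0\<close>.
\<close>

lemma exists_Berge_K3_saturated:
  fixes k d m s :: nat
  assumes d: "d \<ge> 1" and s: "1 \<le> s" "s \<le> d"
  defines "n \<equiv> 1 + (Suc m * d + s)"
  shows "\<exists>H :: nat hypergraph. card (verts H) = n \<and> Berge_saturated (Suc d) (complete_graph 3) H \<and>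
    card (edges H) = m + 2"
proof -
  define A where "A i = insert 0 {1 + i * d..<1 + Suc i * d}" for i
  define c where "c = insert 0 {n - d..<n}"
  define E where "E = insert c (A ` {..m})"
  have le: "i * d < m * d + s" if "i \<le> m" for i
    using mult_le_mono1[OF that, of d] s(1) by linarith
  have n: "n - d = 1 + m * d + s" "n = 1 + m * d + d + s" by (simp_all add: n_def)
  have A_meet: "A i \<inter> A j \<subseteq> {0}" if "i < j" for i j
  proof -
    have "Suc i * d \<le> j * d" using that by (intro mult_right_mono) auto
    then show ?thesis by (auto simp: A_def)
  qed
  have A_meet': "A i \<inter> A j \<subseteq> {0}" if "i \<noteq> j" for i j
    using A_meet[of i j] A_meet[of j i] that by (cases "i < j") auto
  have A_mem: "1 + i * d \<in> A i" for i using d by (simp add: A_def)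
  have inj: "inj A"
  proof (rule injI, rule ccontr)
    fix i j assume "A i = A j" "i \<noteq> j"
    then show False using A_meet'[of i j] A_mem[of i] by auto
  qed
  have c_meet: "A i \<inter> c \<subseteq> {0}" if "i < m" for i
  proof -
    have "Suc i * d \<le> m * d" using that by (intro mult_right_mono) auto
    then show ?thesis by (auto simp: A_def c_def n)
  qed
  have last: "n - 1 \<in> c" "n - 1 \<notin> A i" if "i \<le> m" for i
    using le[OF that] s d by (auto simp: A_def c_def n)
  have "c \<notin> A ` {..m}" using last by blast
  then have cE: "card E = m + 2" using inj by (simp add: E_def card_image inj_on_subset[of A UNIV])
  let ?H = "({..<n}, E)"
  have "card (A i) = Suc d" "card c = Suc d" for i
    using s by (simp_all add: A_def c_def n)
  moreover have "A i \<subseteq> {..<n}" if "i \<le> m" for i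
    using le[OF that] by (auto simp: A_def n)
  moreover have "c \<subseteq> {..<n}" by (auto simp: c_def n)
  ultimately have "uniform (Suc d) ?H"
    by (auto simp: uniform_def hypergraph_def E_def)
  moreover have "{..<n} \<subseteq> \<Union>E"
  proof
    fix x assume x: "x \<in> {..<n}"
    show "x \<in> \<Union>E"
    proof (cases "n - d \<le> x \<or> x = 0")
      case True
      then show ?thesis using x by (auto simp: E_def c_def)
    next
      case False
      let ?i = "(x - 1) div d"
      have "x - 1 < Suc m * d" using False s by (auto simp: n)
      then have "?i \<le> m" using d by (simp add: less_mult_imp_div_less less_Suc_eq_le[symmetric])
      moreover have "x - 1 < d + ?i * d"
        using dividend_less_div_times[of d "x - 1"] d by simp
      then have "1 + ?i * d \<le> x" "x < 1 + Suc ?i * d"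
        using False div_times_less_eq_dividend[of "x - 1" d] unfolding mult_Suc by linarith+
      then have "x \<in> A ?i" by (simp add: A_def)
      ultimately show ?thesis by (auto simp: E_def)
    qed
  qed
  moreover have "a \<inter> b \<subseteq> {0}" if ab: "a \<in> E" "b \<in> E" "a \<noteq> b" "{a, b} \<noteq> {A m, c}" for a b
  proof -
    have cA: "A i \<inter> c \<subseteq> {0}" if "i \<le> m" "A i \<noteq> A m" for i
      using that c_meet[of i] by (cases "i = m") auto
    from ab consider "a = c" | "b = c" | "a \<noteq> c" "b \<noteq> c" by blast
    then show ?thesis
    proof cases
      case 1
      then obtain i where "i \<le> m" "b = A i" using ab by (auto simp: E_def)
      then show ?thesis using cA[of i] 1 ab by (auto simp: doubleton_eq_iff)
    next
      case 2
      then obtain i where "i \<le> m" "a = A i" using ab by (auto simp: E_def)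
      then show ?thesis using cA[of i] 2 ab by (auto simp: doubleton_eq_iff)
    next
      case 3
      then obtain i j where "a = A i" "b = A j" using ab by (auto simp: E_def)
      then show ?thesis using A_meet'[of i j] ab by auto
    qed
  qed
  moreover have "0 \<in> e" if "e \<in> E" for e using that by (auto simp: E_def A_def c_def)
  ultimately have "Berge_saturated (Suc d) (complete_graph 3) ?H"
    using d by (intro Berge_K3_saturated_if_star[where r = 0 and p = "A m" and q = c]) auto
  then show ?thesis using cE by (intro exI[of _ ?H]) auto
qed

theorem theorem5p3:
  fixes k n :: nat
  assumes "k \<ge> 3" and "n \<ge> k + 1"
  shows "int (sat_Berge k n (complete_graph 3)) = \<lceil>(real n - 1) / (real k - 1)\<rceil>"
proof -
  define d where "d = k - 1"
  have k: "k = Suc d" "d \<ge> 2" using assms(1) by (auto simp: d_def)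
  \<comment> \<open>Dividing \<open>n - 2\<close> rather than \<open>n - 1\<close> puts the remainder \<open>s\<close> into \<open>{1..d}\<close>, so that the
    ceiling is \<open>q + 1\<close> in all cases.\<close>
  define q where "q = (n - 2) div d"
  define s where "s = (n - 2) mod d + 1"
  have "n - 2 = q * d + (n - 2) mod d" by (simp add: q_def)
  then have n: "n = 1 + (q * d + s)" and s: "1 \<le> s" "s \<le> d"
    using assms k by (auto simp: s_def Suc_le_eq)
  have "q \<noteq> 0" using n s assms(2) k(1) by (intro notI) simp
  then obtain m where q: "q = Suc m" using not0_implies_Suc by blast
  let ?S = "{card (edges H) | H :: nat hypergraph. card (verts H) = n \<and> Berge_saturated k (complete_graph 3) H}"
  have "Suc q \<in> ?S"
    using exists_Berge_K3_saturated[of d s m] k s n q by force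
  moreover have "Suc q \<le> c" if c: "c \<in> ?S" for c
  proof -
    obtain H :: "nat hypergraph" where H: "c = card (edges H)" "card (verts H) = n"
      "Berge_saturated k (complete_graph 3) H" using c by auto
    have unif: "uniform k H" using H(3) by (simp add: Berge_saturated_def)
    have "card (verts H) \<le> 1 + (k - 1) * card (edges H)"
    proof (rule card_verts_le_if_linked)
      show "finite (verts H)" using unif by (simp add: uniform_def hypergraph_def)
      show "e \<subseteq> verts H \<and> card e = k" if "e \<in> edges H" for e
        using unif that by (simp add: uniform_def hypergraph_def)
      show "\<exists>x\<in>e. \<exists>y\<in>e. x \<noteq> y \<and> linked (edges H) x y"
        if "e \<subseteq> verts H" "card e = k" "e \<notin> edges H" for e
        using H(3) that unfolding Berge_K3_saturated_iff[OF unif] by blast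
    qed (use assms H(2) in auto)
    then have "q * d + s \<le> d * c" using H n k by simp
    then have "d * q < d * c" using s(1) mult.commute[of q d] by linarith
    then show ?thesis by (simp add: Suc_le_eq)
  qed
  ultimately have "sat_Berge k n (complete_graph 3) = Suc q"
    unfolding sat_Berge_def by (intro cInf_eq_minimum) auto
  moreover have "\<lceil>(real n - 1) / (real k - 1)\<rceil> = int (Suc q)"
    using s k(2) by (intro ceiling_unique) (auto simp: n k(1) field_simps)
  ultimately show ?thesis by simp
qed

end
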